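(* For real $\nu\ge 0$ let $L_\nu=\frac{1}{2\pi}\int_{-\pi}^{\pi}\left|\frac{\sin((\nu+\frac12)t)}{\sin(t/2)}\right|dt$, so that for integers $n\ge0$, $L_{n/2}=\frac{1}{2\pi}\int_{-\pi}^{\pi}\left|\frac{\sin((n+1)t/2)}{\sin(t/2)}\right|dt$. Let $$c_1=\frac{8}{\pi^2}\sum_{k=1}^{\infty}\frac{\ln k}{4k^2-1}+\frac{4}{\pi^2}(\gamma+2\ln 2),$$ where $\gamma$ is the Euler–Mascheroni constant, and let $\mathrm{MC}_0(n)=\frac{4}{\pi^2}\ln(n+1)+c_1$. With $y=(n+1)^2$ define $$\mathrm{MC}_1(n)=\frac{\rho_1}{y+\varrho_1},\qquad \mathrm{MC}_2(n)=\cfrac{\rho_1}{y+\varrho_1+\cfrac{\rho_2}{y+\varrho_2}},$$ where $$\rho_1=\frac{12-\pi^2}{18\pi^2},\qquad \varrho_1=\frac{7(-720+60\pi^2+\pi^4)}{600(-12+\pi^2)},$$ $$\rho_2=-\frac{7515244800-1252540800\pi^2+46937520\pi^4+65640\pi^6+23797\pi^8}{52920000(-12+\pi^2)^2},$$ $$\varrho_2=\frac{7(-36262162944000+9065540736000\pi^2-720128102400\pi^4+16206350400\pi^6+117169920\pi^8+288540\pi^{10}+230953\pi^{12})}{600(-90182937600+22545734400\pi^2-1815791040\pi^4+46149840\pi^6-219924\pi^8+23797\pi^{10})}.$$ For $k\in\{1,2\}$ let $E_k(n)=L_{n/2}-\mathrm{MC}_0(n)-\mathrm{MC}_k(n)$.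 Then for $k\in\{1,2\}$, $$\lim_{n\to\infty}n^{4k+3}\bigl(E_k(n)-E_k(n+1)\bigr)=(4k+2)C_k,\qquad \lim_{n\to\infty}n^{4k+2}E_k(n)=C_k,$$ where $$C_1=\frac{-7515244800+1252540800\pi^2-46937520\pi^4-65640\pi^6-23797\pi^8}{952560000\pi^2(-12+\pi^2)},$$ $$C_2=\frac{N_2}{97592743987200\pi^2(7515244800-1252540800\pi^2+46937520\pi^4+65640\pi^6+23797\pi^8)},$$ with $N_2=7633889107527073628160000-1908472276881768407040000\pi^2+146687085183488661504000\pi^4-3184401328004768256000\pi^6+50811629937851059200\pi^8-5860796365392595200\pi^{10}+73433337261096960\pi^{12}-2698623258901920\pi^{14}-13989723377364\pi^{16}-552278517605\pi^{18}$.
   Context: $\gamma=\lim_{n\to\infty}\left(\sum_{m=1}^n\frac1m-\ln n\right)$ is the Euler–Mascheroni constant. The numbers $L_n$ are the Lebesgue constants. *)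

theory Defs
  imports "HOL-Analysis.Analysis"
begin

text \<open>The integrand has a removable singularity at \<open>t = 0\<close>, where division by zero makes it \<open>0\<close>;
  this does not affect the integral.\<close>

definition lebesgue_const :: "real \<Rightarrow> real" where
  "lebesgue_const \<nu> =
     1 / (2 * pi) * integral {-pi..pi} (\<lambda>t. \<bar>sin ((\<nu> + 1/2) * t) / sin (t / 2)\<bar>)"

lemma lebesgue_const_half:
  fixes n :: nat
  shows "lebesgue_const (real n / 2) =
     1 / (2 * pi) * integral {-pi..pi} (\<lambda>t. \<bar>sin ((real n + 1) * t / 2) / sin (t / 2)\<bar>)"
proof -
  have "(real n / 2 + 1/2) * t = (real n + 1) * t / 2" for t :: real
    by (simp add: field_simps)
  then show ?thesis
    unfolding lebesgue_const_def by (simp only:)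
qed

text \<open>The series over \<open>k \<ge> 1\<close> is indexed by \<open>Suc k\<close> with \<open>k \<ge> 0\<close>.\<close>

definition c\<^sub>1 :: real where
  "c\<^sub>1 = 8 / pi^2 * (\<Sum>k. ln (real (Suc k)) / (4 * real (Suc k)^2 - 1))
        + 4 / pi^2 * (euler_mascheroni + 2 * ln 2)"

definition MC\<^sub>0 :: "nat \<Rightarrow> real" where
  "MC\<^sub>0 n = 4 / pi^2 * ln (real n + 1) + c\<^sub>1"

definition \<rho>\<^sub>1 :: real where
  "\<rho>\<^sub>1 = (12 - pi^2) / (18 * pi^2)"

text \<open>\<open>\<sigma>\<^sub>i\<close> stands for the shift usually written varrho with index \<open>i\<close>.\<close>

definition \<sigma>\<^sub>1 :: real where
  "\<sigma>\<^sub>1 = 7 * (-720 + 60 * pi^2 + pi^4) / (600 * (-12 + pi^2))"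

definition \<rho>\<^sub>2 :: real where
  "\<rho>\<^sub>2 = - ((7515244800 - 1252540800 * pi^2 + 46937520 * pi^4 + 65640 * pi^6 + 23797 * pi^8)
          / (52920000 * (-12 + pi^2)^2))"

definition \<sigma>\<^sub>2 :: real where
  "\<sigma>\<^sub>2 = 7 * (-36262162944000 + 9065540736000 * pi^2 - 720128102400 * pi^4
              + 16206350400 * pi^6 + 117169920 * pi^8 + 288540 * pi^10 + 230953 * pi^12)
        / (600 * (-90182937600 + 22545734400 * pi^2 - 1815791040 * pi^4
              + 46149840 * pi^6 - 219924 * pi^8 + 23797 * pi^10))"

definition MC\<^sub>1 :: "nat \<Rightarrow> real" where
  "MC\<^sub>1 n = (let y = (real n + 1)^2 in \<rho>\<^sub>1 / (y + \<sigma>\<^sub>1))"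

definition MC\<^sub>2 :: "nat \<Rightarrow> real" where
  "MC\<^sub>2 n = (let y = (real n + 1)^2 in \<rho>\<^sub>1 / (y + \<sigma>\<^sub>1 + \<rho>\<^sub>2 / (y + \<sigma>\<^sub>2)))"

definition C\<^sub>1 :: real where
  "C\<^sub>1 = (-7515244800 + 1252540800 * pi^2 - 46937520 * pi^4 - 65640 * pi^6 - 23797 * pi^8)
        / (952560000 * pi^2 * (-12 + pi^2))"

definition N\<^sub>2 :: real where
  "N\<^sub>2 = 7633889107527073628160000
        - 1908472276881768407040000 * pi^2
        + 146687085183488661504000 * pi^4
        - 3184401328004768256000 * pi^6
        + 50811629937851059200 * pi^8
        - 5860796365392595200 * pi^10
        + 73433337261096960 * pi^12
        - 2698623258901920 * pi^14
        - 13989723377364 * pi^16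
        - 552278517605 * pi^18"

definition C\<^sub>2 :: real where
  "C\<^sub>2 = N\<^sub>2 / (97592743987200 * pi^2 *
        (7515244800 - 1252540800 * pi^2 + 46937520 * pi^4 + 65640 * pi^6 + 23797 * pi^8))"

text \<open>The following three are only meaningful for \<open>k \<in> {1, 2}\<close>.\<close>

definition MC :: "nat \<Rightarrow> nat \<Rightarrow> real" where
  "MC k = (if k = 1 then MC\<^sub>1 else MC\<^sub>2)"

definition MC_error :: "nat \<Rightarrow> nat \<Rightarrow> real" where
  "MC_error k n = lebesgue_const (real n / 2) - MC\<^sub>0 n - MC k n"

definition MC_limit :: "nat \<Rightarrow> real" where
  "MC_limit k = (if k = 1 then C\<^sub>1 else C\<^sub>2)"

end

theory Submission
  imports Defs "HOL-Real_Asymp.Real_Asymp"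
begin

text \<open>
  The logarithmic series of \<open>artanh\<close> on the unit circle gives \<open>\<Sum> cos (2 k x) / (4 k\<^sup>2 - 1) = 1/2 - \<pi>/4 |sin x|\<close>,
  equivalently \<open>|sin x| = 8/\<pi> \<Sum> sin\<^sup>2 (k x) / (4 k\<^sup>2 - 1)\<close>. Since \<open>sin\<^sup>2 (m x) / sin x\<close> is a sum of sines of
  odd multiples of \<open>x\<close>, integrating the second series termwise yields Szego's formula
  \<open>L = 16/\<pi>\<^sup>2 \<Sum> O (k N) / (4 k\<^sup>2 - 1)\<close> for \<open>N = n + 1\<close>, where \<open>O m\<close> is the sum of the first \<open>m\<close>
  reciprocals of odd numbers. Inserting the asymptotic expansion of \<open>O m\<close> gives an expansion of \<open>L\<close>
  in powers of \<open>1/N\<^sup>2\<close> with error \<open>O(1/N^12)\<close>. Its coefficients involve the moments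
  \<open>\<Sum> k^(-2 j) / (4 k\<^sup>2 - 1)\<close>. Integrating the first series \<open>2 j + 1\<close> times and evaluating at a zero of all
  \<open>sin (2 k x)\<close> gives a recurrence for them. The continued fractions are the Pade approximants of the
  expansion in \<open>1/N\<^sup>2\<close>, and \<open>C\<^sub>1\<close>, \<open>C\<^sub>2\<close> are the first coefficients in which they differ from it.
\<close>

subsection \<open>Series and Landau symbols\<close>

lemma powser_sums_boundary:
  fixes a :: "nat \<Rightarrow> 'a :: {real_normed_field, banach}"
  assumes a: "summable (\<lambda>k. norm (a k))"
    and F: "\<And>z. norm z < 1 \<Longrightarrow> z \<noteq> 0 \<Longrightarrow> (\<lambda>k. a k * z ^ e k) sums F z"
    and u: "norm u = 1" "isCont F u"
  shows "(\<lambda>k. a k * u ^ e k) sums F u"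
proof -
  define S where "S z = (\<Sum>k. a k * z ^ e k)" for z
  have term_le: "norm (a k * z ^ e k) \<le> norm (a k)" if "z \<in> cball 0 1" for k z
    using that by (simp add: norm_mult norm_power mult_left_le power_le_one)
  have "uniform_limit (cball 0 1) (\<lambda>n z. \<Sum>k<n. a k * z ^ e k) S sequentially"
    unfolding S_def by (rule Weierstrass_m_test[OF term_le a])
  then have "continuous_on (cball 0 1) S"
    by (rule uniform_limit_theorem[rotated]) (auto intro!: always_eventually continuous_intros)
  define X where "X n = u * of_real (1 - 1 / real (n + 2))" for n
  have "(\<lambda>n. 1 - 1 / real (n + 2)) \<longlonglongrightarrow> 1"
    by real_asymp
  from tendsto_mult[OF tendsto_const tendsto_of_real[OF this], of u] have X: "X \<longlonglongrightarrow> u"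
    by (simp add: X_def[abs_def])
  have "norm (X n) = 1 - 1 / real (n + 2)" for n
    unfolding X_def norm_mult norm_of_real u(1) by simp
  then have norm_X: "norm (X n) < 1" "X n \<noteq> 0" for n
    using norm_eq_zero[of "X n"] by auto
  have "(\<lambda>n. S (X n)) \<longlonglongrightarrow> S u"
    by (rule continuous_on_tendsto_compose[OF \<open>continuous_on (cball 0 1) S\<close> X])
      (use u norm_X in \<open>auto intro!: always_eventually less_imp_le\<close>)
  moreover have "S (X n) = F (X n)" for n
    unfolding S_def using F[OF norm_X] by (rule sums_unique[symmetric])
  moreover have "(\<lambda>n. F (X n)) \<longlonglongrightarrow> F u"
    using u(2) X by (rule isCont_tendsto_compose)
  ultimately have "S u = F u"
    using LIMSEQ_unique by simp
  moreover have "summable (\<lambda>k. a k * u ^ e k)"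
    by (rule summable_comparison_test'[OF a term_le]) (simp add: u)
  ultimately show ?thesis
    by (simp add: S_def sums_iff)
qed

lemma sums_antiderivative:
  fixes f :: "nat \<Rightarrow> 'a \<Rightarrow> 'a :: {real_normed_field, banach}"
  assumes "convex S"
    and f: "\<And>k x. x \<in> S \<Longrightarrow> (f k has_field_derivative f' k x) (at x within S)"
    and bound: "\<And>k x. x \<in> S \<Longrightarrow> norm (f' k x) \<le> M k" "summable M"
    and P: "\<And>x. x \<in> S \<Longrightarrow> (\<lambda>k. f' k x) sums P x"
    and Q: "\<And>x. x \<in> S \<Longrightarrow> (Q has_field_derivative P x) (at x within S)"
    and a: "a \<in> S" "(\<lambda>k. f k a) sums Q a"
    and x: "x \<in> S"
  shows "(\<lambda>k. f k x) sums Q x"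
proof -
  have "uniform_limit S (\<lambda>n x. \<Sum>k<n. f' k x) (\<lambda>x. \<Sum>k. f' k x) sequentially"
    using bound by (intro Weierstrass_m_test[where M = M]) auto
  also have "?this \<longleftrightarrow> uniform_limit S (\<lambda>n x. \<Sum>k<n. f' k x) P sequentially"
    using P by (intro uniform_limit_cong') (auto simp: sums_iff)
  finally obtain g where g: "\<And>x. x \<in> S \<Longrightarrow> (\<lambda>k. f k x) sums g x"
      "\<And>x. x \<in> S \<Longrightarrow> (g has_field_derivative P x) (at x within S)"
    using has_field_derivative_series[OF assms(1) f _ a(1) sums_summable[OF a(2)]] by blast
  have "\<exists>c. \<forall>x\<in>S. g x - Q x = c"
    using DERIV_diff[OF g(2) Q] by (intro has_field_derivative_zero_constant[OF assms(1)]) simp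
  moreover have "g a = Q a"
    using sums_unique2[OF g(1)[OF a(1)] a(2)] .
  ultimately have "g x = Q x"
    using x a(1) by (metis diff_self eq_iff_diff_eq_0)
  then show ?thesis
    using g(1)[OF x] by simp
qed

lemma bigo_of_increments:
  fixes f g :: "nat \<Rightarrow> real"
  assumes f: "f \<longlonglongrightarrow> 0" and g: "g \<longlonglongrightarrow> 0"
    and decreasing: "\<forall>\<^sub>F n in sequentially. g (Suc n) \<le> g n"
    and increments: "(\<lambda>n. f (Suc n) - f n) \<in> O(\<lambda>n. g (Suc n) - g n)"
  shows "f \<in> O(g)"
proof -
  obtain c where "c > 0" "\<forall>\<^sub>F n in sequentially. norm (f (Suc n) - f n) \<le> c * norm (g (Suc n) - g n)"
    using landau_o.bigE[OF increments] by blast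
  from this(2) decreasing have "\<forall>\<^sub>F n in sequentially. \<bar>f (Suc n) - f n\<bar> \<le> c * (g n - g (Suc n))"
    by eventually_elim simp
  then obtain N where N: "\<bar>f (Suc n) - f n\<bar> \<le> c * (g n - g (Suc n))" if "n \<ge> N" for n
    by (auto simp: eventually_sequentially)
  have "\<bar>f n\<bar> \<le> c * g n" if "n \<ge> N" for n
  proof -
    have "\<bar>f (n + i) - f n\<bar> \<le> c * (g n - g (n + i))" for i
    proof (induction i)
      case (Suc i)
      then show ?case
        using N[of "n + i"] that by (simp add: algebra_simps)
    qed simp
    moreover have "(\<lambda>i. \<bar>f (n + i) - f n\<bar>) \<longlonglongrightarrow> \<bar>0 - f n\<bar>"
      using LIMSEQ_ignore_initial_segment[OF f, of n]
      by (intro tendsto_intros) (simp add: add.commute)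
    moreover have "(\<lambda>i. c * (g n - g (n + i))) \<longlonglongrightarrow> c * (g n - 0)"
      using LIMSEQ_ignore_initial_segment[OF g, of n]
      by (intro tendsto_intros) (simp add: add.commute)
    ultimately show ?thesis
      using LIMSEQ_le by fastforce
  qed
  moreover have "c * g n \<le> c * \<bar>g n\<bar>" for n
    using \<open>c > 0\<close> by (intro mult_left_mono) auto
  ultimately have "norm (f n) \<le> c * norm (g n)" if "n \<ge> N" for n
    using that order_trans by fastforce
  then show ?thesis
    by (intro bigoI[of _ c] eventually_sequentiallyI[of N])
qed

lemma bigo_sum_dilations:
  fixes r R w :: "nat \<Rightarrow> real"
  assumes r: "r \<in> O(\<lambda>m. 1 / real m ^ p)"
    and w: "summable w" "\<And>k. w k \<ge> 0"
    and R: "\<And>n. (\<lambda>k. w k * r (Suc k * Suc n)) sums R n"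
  shows "R \<in> O(\<lambda>n. 1 / real (Suc n) ^ p)"
proof -
  obtain c where "c > 0" "\<forall>\<^sub>F m in sequentially. norm (r m) \<le> c * norm (1 / real m ^ p)"
    using landau_o.bigE[OF r] by blast
  then obtain M where M: "\<bar>r m\<bar> \<le> c / real m ^ p" if "m \<ge> M" for m
    by (auto simp: eventually_sequentially)
  have "\<bar>R n\<bar> \<le> (\<Sum>k. w k * (c / real (Suc n) ^ p))" if "n \<ge> M" for n
    unfolding sums_unique[OF R] real_norm_def[symmetric]
  proof (rule norm_suminf_le[OF _ summable_mult2[OF w(1)]])
    fix k
    have "Suc n \<le> Suc k * Suc n"
      by simp
    with that have "M \<le> Suc k * Suc n"
      by linarith
    then have "\<bar>r (Suc k * Suc n)\<bar> \<le> c / real (Suc k * Suc n) ^ p"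
      by (rule M)
    also have "\<dots> \<le> c / real (Suc n) ^ p"
      using \<open>c > 0\<close> of_nat_mono[OF \<open>Suc n \<le> Suc k * Suc n\<close>, where 'a = real]
      by (intro frac_le power_mono) simp_all
    finally show "norm (w k * r (Suc k * Suc n)) \<le> w k * (c / real (Suc n) ^ p)"
      unfolding real_norm_def abs_mult abs_of_nonneg[OF w(2)] by (rule mult_left_mono) (rule w(2))
  qed
  then have "\<bar>R n\<bar> \<le> (suminf w * c) * (1 / real (Suc n) ^ p)" if "n \<ge> M" for n
    using that suminf_mult2[OF w(1), of "c / real (Suc n) ^ p"] by simp
  then show ?thesis
    by (intro bigoI[of _ "suminf w * c"] eventually_sequentiallyI[of M]) simp
qed

lemma bigo_of_bigo_mult:
  fixes f D :: "'a \<Rightarrow> 'b :: real_normed_field"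
  assumes "(\<lambda>x. f x * D x) \<in> O[F](g)" "(\<lambda>x. inverse (D x)) \<in> O[F](h)" "filterlim D at_infinity F"
  shows "f \<in> O[F](\<lambda>x. g x * h x)"
proof -
  have "(\<lambda>x. f x * D x * inverse (D x)) \<in> O[F](\<lambda>x. g x * h x)"
    using assms(1,2) by (rule landau_o.big.mult)
  also have "?this \<longleftrightarrow> ?thesis"
    using filterlim_at_infinity_imp_eventually_ne[OF assms(3), of 0]
    by (intro landau_o.big.in_cong) (auto elim!: eventually_mono)
  finally show ?thesis .
qed

lemma power_mult_bigo_tendsto_0:
  fixes r :: "nat \<Rightarrow> real"
  assumes r: "r \<in> O(\<lambda>n. 1 / real (Suc n) ^ Suc p)" and "q \<le> p"
  shows "(\<lambda>n. real n ^ q * r (n + i)) \<longlonglongrightarrow> 0"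
proof (rule Lim_null_comparison)
  have "(\<lambda>n. real (Suc n) ^ p * r n) \<in> O(\<lambda>n. real (Suc n) ^ p * (1 / real (Suc n) ^ Suc p))"
    by (intro landau_o.big.mult_left r)
  also have "(\<lambda>n. real (Suc n) ^ p * (1 / real (Suc n) ^ Suc p)) = (\<lambda>n. 1 / real (Suc n))"
    by (simp add: fun_eq_iff del: of_nat_Suc)
  also have "(\<lambda>n. 1 / real (Suc n)) \<in> o(\<lambda>n. 1)"
    by real_asymp
  finally have "(\<lambda>n. real (Suc n) ^ p * r n) \<longlonglongrightarrow> 0"
    using smalloD_tendsto by fastforce
  then show "(\<lambda>n. norm (real (Suc (n + i)) ^ p * r (n + i))) \<longlonglongrightarrow> 0"
    by (intro tendsto_norm_zero LIMSEQ_ignore_initial_segment)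
  have "real n ^ q \<le> real (Suc (n + i)) ^ p" for n
    using power_mono[of "real n" "real (Suc (n + i))" q]
      power_increasing[OF \<open>q \<le> p\<close>, of "real (Suc (n + i))"]
    by simp
  then have power_le: "norm (real n ^ q) \<le> norm (real (Suc (n + i)) ^ p)" for n
    unfolding norm_power norm_of_nat .
  show "\<forall>\<^sub>F n in sequentially. norm (real n ^ q * r (n + i)) \<le> norm (real (Suc (n + i)) ^ p * r (n + i))"
    unfolding norm_mult
    by (rule always_eventually, rule allI, rule mult_right_mono[OF power_le norm_ge_zero])
qed

lemma inverse_power_difference_tendsto:
  "(\<lambda>n. real n ^ (p + 1) * (1 / real (Suc n) ^ p - 1 / real (Suc (Suc n)) ^ p)) \<longlonglongrightarrow> real p"
  by real_asymp

lemma inverse_power_expansion_limits: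
  fixes E :: "nat \<Rightarrow> real"
  assumes E: "(\<lambda>n. E n - C / real (Suc n) ^ p) \<in> O(\<lambda>n. 1 / real (Suc n) ^ (p + 2))"
  shows "(\<lambda>n. real n ^ (p + 1) * (E n - E (n + 1))) \<longlonglongrightarrow> real p * C"
    and "(\<lambda>n. real n ^ p * E n) \<longlonglongrightarrow> C"
proof -
  define r where "r n = E n - C / real (Suc n) ^ p" for n
  have r_tendsto: "(\<lambda>n. real n ^ q * r (n + i)) \<longlonglongrightarrow> 0" if "q \<le> p + 1" for q i
    using E that by (intro power_mult_bigo_tendsto_0[of r "p + 1"]) (simp_all add: r_def[abs_def])
  have "(\<lambda>n. C * (real n ^ (p + 1) * (1 / real (Suc n) ^ p - 1 / real (Suc (Suc n)) ^ p))
        + (real n ^ (p + 1) * r (n + 0) - real n ^ (p + 1) * r (n + 1))) \<longlonglongrightarrow> C * real p + (0 - 0)"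
    by (intro tendsto_add tendsto_mult tendsto_diff tendsto_const inverse_power_difference_tendsto r_tendsto) auto
  then show "(\<lambda>n. real n ^ (p + 1) * (E n - E (n + 1))) \<longlonglongrightarrow> real p * C"
    by (simp add: r_def algebra_simps)
  have "(\<lambda>n. real n / real (Suc n)) \<longlonglongrightarrow> 1"
    by real_asymp
  then have "(\<lambda>n. C * (real n / real (Suc n)) ^ p + real n ^ p * r (n + 0)) \<longlonglongrightarrow> C * 1 ^ p + 0"
    by (intro tendsto_add tendsto_mult tendsto_power tendsto_const r_tendsto) auto
  then show "(\<lambda>n. real n ^ p * E n) \<longlonglongrightarrow> C"
    by (simp add: r_def algebra_simps power_divide)
qed

subsection \<open>The Fourier series of the absolute sine\<close>

definition abs_sin_coeff :: "nat \<Rightarrow> real" where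
  "abs_sin_coeff k = 1 / (4 * real k ^ 2 - 1)"

lemma abs_sin_coeff_pos:
  assumes "k > 0"
  shows "abs_sin_coeff k > 0"
proof -
  have "1 \<le> real k ^ 2"
    using assms by (intro one_le_power) simp
  then show ?thesis
    by (simp add: abs_sin_coeff_def)
qed

lemma abs_sin_coeff_Suc:
  "abs_sin_coeff (Suc k) = (1 / (2 * real k + 1) - 1 / (2 * real (Suc k) + 1)) / 2"
proof -
  have "4 * real (Suc k) ^ 2 - 1 = (2 * real k + 1) * (2 * real (Suc k) + 1)"
    by (simp add: power2_eq_square algebra_simps)
  then show ?thesis
    unfolding abs_sin_coeff_def by (simp only:) (simp add: divide_simps)
qed

lemma abs_sin_coeff_sums: "(\<lambda>k. abs_sin_coeff (Suc k)) sums (1 / 2)"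
proof -
  have "(\<lambda>k. 1 / (2 * real k + 1)) \<longlonglongrightarrow> 0"
    by real_asymp
  from sums_divide[OF telescope_sums'[OF this], of 2] show ?thesis
    by (simp add: abs_sin_coeff_Suc)
qed

lemma artanh_sums:
  fixes z :: complex
  assumes "norm z < 1"
  shows "(\<lambda>k. z ^ (2 * k + 1) / of_nat (2 * k + 1)) sums artanh z"
proof -
  have "(\<lambda>k. (-1) ^ k / of_nat (2 * k + 1) * (\<i> * z) ^ (2 * k + 1)) sums Arctan (\<i> * z)"
    using assms by (intro Arctan_series(2)) (simp add: norm_mult)
  from sums_mult[OF this, of "- \<i>"]
  have "(\<lambda>k. - \<i> * ((-1) ^ k / of_nat (2 * k + 1) * (\<i> * z) ^ (2 * k + 1))) sums (- \<i> * Arctan (\<i> * z))" .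
  moreover have "- \<i> * ((-1) ^ k / of_nat (2 * k + 1) * (\<i> * z) ^ (2 * k + 1))
      = z ^ (2 * k + 1) / of_nat (2 * k + 1)" for k
  proof -
    have "(\<i> * z) ^ (2 * k + 1) = (-1) ^ k * (\<i> * z ^ (2 * k + 1))"
      using power_minus[of "z\<^sup>2" k] by (simp add: power_mult_distrib power_mult)
    then show ?thesis
      by (simp only:) simp
  qed
  moreover have "- \<i> * Arctan (\<i> * z) = artanh z"
    by (simp add: Arctan_def artanh_def)
  ultimately show ?thesis
    by simp
qed

lemma abs_sin_coeff_powser_sums:
  fixes z :: complex
  assumes "norm z < 1" "z \<noteq> 0"
  shows "(\<lambda>k. of_real (abs_sin_coeff (Suc k)) * z ^ (2 * Suc k)) sums ((1 + (z - 1 / z) * artanh z) / 2)"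
proof -
  define a where "a k = z ^ (2 * k + 1) / of_nat (2 * k + 1)" for k
  have a: "a sums artanh z"
    unfolding a_def by (rule artanh_sums[OF assms(1)])
  moreover have "(\<lambda>k. a (Suc k)) sums (artanh z - z)"
    using a by (subst sums_Suc_iff) (simp add: a_def)
  ultimately have "(\<lambda>k. (z * a k - a (Suc k) / z) / 2) sums ((z * artanh z - (artanh z - z) / z) / 2)"
    by (intro sums_divide sums_diff sums_mult)
  also have "(z * artanh z - (artanh z - z) / z) / 2 = (1 + (z - 1 / z) * artanh z) / 2"
    using assms by (simp add: field_simps)
  also have "(\<lambda>k. (z * a k - a (Suc k) / z) / 2) = (\<lambda>k. of_real (abs_sin_coeff (Suc k)) * z ^ (2 * Suc k))"
  proof
    fix k
    have "of_real (abs_sin_coeff (Suc k)) = (1 / of_nat (2 * k + 1) - 1 / of_nat (2 * Suc k + 1)) / (2 :: complex)"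
      by (simp add: abs_sin_coeff_Suc)
    then show "(z * a k - a (Suc k) / z) / 2 = of_real (abs_sin_coeff (Suc k)) * z ^ (2 * Suc k)"
      using assms by (simp only: a_def) (simp add: diff_divide_distrib left_diff_distrib)
  qed
  finally show ?thesis .
qed

lemma artanh_cis:
  assumes "sin x > 0"
  shows "isCont artanh (cis x)" and "Im (artanh (cis x)) = pi / 4"
proof -
  have "cos x \<noteq> 1"
    using assms sin_cos_squared_add[of x] by force
  then have "cos x < 1"
    using cos_le_one[of x] by linarith
  have "1 - cis x \<noteq> 0"
    using assms by (auto simp: complex_eq_iff)
  have "(1 + cis x) / (1 - cis x) = \<i> * of_real (sin x / (1 - cos x))"
  proof -
    have "1 + cis x = \<i> * of_real (sin x / (1 - cos x)) * (1 - cis x)"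
      using \<open>cos x \<noteq> 1\<close> sin_cos_squared_add[of x]
      by (simp add: complex_eq_iff field_simps power2_eq_square)
    then show ?thesis
      using \<open>1 - cis x \<noteq> 0\<close> by simp
  qed
  then have "Re ((1 + cis x) / (1 - cis x)) = 0" and Im: "Im ((1 + cis x) / (1 - cis x)) > 0"
    using assms \<open>cos x < 1\<close> by simp_all
  then have "Im (Ln ((1 + cis x) / (1 - cis x))) = pi / 2"
    by (subst Im_Ln_eq_pi_half) auto
  then show "Im (artanh (cis x)) = pi / 4"
    by (simp add: artanh_def)
  show "isCont artanh (cis x)"
    unfolding artanh_def using Im \<open>1 - cis x \<noteq> 0\<close>
    by (intro continuous_intros) (auto simp: complex_nonpos_Reals_iff)
qed

lemma sin_pos_cos_sums:
  assumes "sin x > 0"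
  shows "(\<lambda>k. abs_sin_coeff (Suc k) * cos (2 * real (Suc k) * x)) sums (1 / 2 - pi / 4 * sin x)"
proof -
  have "(\<lambda>k. of_real (abs_sin_coeff (Suc k)) * cis x ^ (2 * Suc k)) sums
      ((1 + (cis x - 1 / cis x) * artanh (cis x)) / 2)"
  proof (rule powser_sums_boundary)
    show "summable (\<lambda>k. norm (complex_of_real (abs_sin_coeff (Suc k))))"
      using sums_summable[OF abs_sin_coeff_sums] by (simp add: abs_of_pos abs_sin_coeff_pos)
    show "isCont (\<lambda>z. (1 + (z - 1 / z) * artanh z) / 2) (cis x)"
      by (intro continuous_intros artanh_cis assms) simp_all
  qed (use abs_sin_coeff_powser_sums in simp_all)
  from sums_Re[OF this]
  have "(\<lambda>k. abs_sin_coeff (Suc k) * Re (cis x ^ (2 * Suc k))) sums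
      ((1 + Re ((cis x - 1 / cis x) * artanh (cis x))) / 2)"
    by simp
  also have "cis x - 1 / cis x = 2 * \<i> * of_real (sin x)"
    by (simp add: complex_eq_iff divide_inverse)
  also have "(1 + Re (2 * \<i> * of_real (sin x) * artanh (cis x))) / 2 = 1 / 2 - pi / 4 * sin x"
    using artanh_cis(2)[OF assms] by (simp add: add_divide_distrib)
  finally show ?thesis
    by (simp only: Complex.DeMoivre cis.sel of_nat_mult of_nat_numeral)
qed

lemma abs_sin_cos_sums:
  "(\<lambda>k. abs_sin_coeff (Suc k) * cos (2 * real (Suc k) * x)) sums (1 / 2 - pi / 4 * \<bar>sin x\<bar>)"
proof -
  consider (positive) "sin x > 0" | (negative) "sin x < 0" | (zero) "sin x = 0"
    by linarith
  then show ?thesis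
  proof cases
    case positive
    then show ?thesis using sin_pos_cos_sums by simp
  next
    case negative
    then show ?thesis using sin_pos_cos_sums[of "- x"] by simp
  next
    case zero
    then obtain i :: int where "x = of_int i * pi"
      by (auto simp: sin_zero_iff_int2)
    then have "2 * real (Suc k) * x = 2 * pi * of_int (int (Suc k) * i)" for k
      by simp
    then have "cos (2 * real (Suc k) * x) = 1" for k
      by (simp only: cos_int_2pin)
    then show ?thesis
      using abs_sin_coeff_sums zero by simp
  qed
qed

lemma abs_sin_sin_square_sums:
  "(\<lambda>k. abs_sin_coeff (Suc k) * (sin (real (Suc k) * x))\<^sup>2) sums (pi / 8 * \<bar>sin x\<bar>)"
proof -
  have "(\<lambda>k. (abs_sin_coeff (Suc k) - abs_sin_coeff (Suc k) * cos (2 * real (Suc k) * x)) / 2)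
      sums ((1 / 2 - (1 / 2 - pi / 4 * \<bar>sin x\<bar>)) / 2)"
    by (intro sums_divide sums_diff abs_sin_coeff_sums abs_sin_cos_sums)
  moreover have "(abs_sin_coeff (Suc k) - abs_sin_coeff (Suc k) * cos (2 * real (Suc k) * x)) / 2
      = abs_sin_coeff (Suc k) * (sin (real (Suc k) * x))\<^sup>2" for k
    using cos_double_sin[of "real (Suc k) * x"] by (simp only: mult.assoc) (simp add: algebra_simps)
  ultimately show ?thesis
    by simp
qed

subsection \<open>Moments of the Fourier coefficients\<close>

definition abs_sin_weight :: "nat \<Rightarrow> nat \<Rightarrow> real" where
  "abs_sin_weight j k = abs_sin_coeff (Suc k) / real (Suc k) ^ j"

definition abs_sin_moment :: "nat \<Rightarrow> real" where
  "abs_sin_moment j = (\<Sum>k. abs_sin_weight (2 * j) k)"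

lemma abs_sin_weight_mult_le:
  assumes "\<bar>t\<bar> \<le> 1"
  shows "\<bar>abs_sin_weight j k * t\<bar> \<le> abs_sin_coeff (Suc k)"
proof -
  have pos: "abs_sin_coeff (Suc k) > 0"
    by (rule abs_sin_coeff_pos) simp
  have "\<bar>t\<bar> \<le> real (Suc k) ^ j"
    by (rule order_trans[OF assms one_le_power]) simp
  with pos have "abs_sin_coeff (Suc k) * \<bar>t\<bar> \<le> abs_sin_coeff (Suc k) * real (Suc k) ^ j"
    by (intro mult_left_mono) auto
  then show ?thesis
    using pos by (simp add: abs_sin_weight_def abs_mult pos_divide_le_eq del: of_nat_Suc)
qed

lemma abs_sin_moment_sums: "abs_sin_weight (2 * j) sums abs_sin_moment j"
  unfolding abs_sin_moment_def
  by (intro summable_sums summable_comparison_test'[OF sums_summable[OF abs_sin_coeff_sums], where N = 0])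
    (use abs_sin_weight_mult_le[of 1] in simp)

lemma abs_sin_moment_0: "abs_sin_moment 0 = 1 / 2"
  using sums_unique2[OF abs_sin_moment_sums[of 0]] abs_sin_coeff_sums
  by (simp add: abs_sin_weight_def[abs_def])

definition cos_convolution :: "(nat \<Rightarrow> real) \<Rightarrow> nat \<Rightarrow> real \<Rightarrow> real" where
  "cos_convolution a j x = (\<Sum>i\<le>j. a (j - i) * ((-1) ^ i * (x ^ (2 * i) / fact (2 * i))))"

definition sin_convolution :: "(nat \<Rightarrow> real) \<Rightarrow> nat \<Rightarrow> real \<Rightarrow> real" where
  "sin_convolution a j x = (\<Sum>i\<le>j. a (j - i) * ((-1) ^ i * (x ^ (2 * i + 1) / fact (2 * i + 1))))"

lemma cos_convolution_0 [simp]: "cos_convolution a j 0 = a j"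
  by (simp add: cos_convolution_def sum.atMost_shift)

lemma sin_convolution_0 [simp]: "sin_convolution a j 0 = 0"
  by (simp add: sin_convolution_def)

lemma sin_convolution_shift: "sin_convolution (case_nat 0 a) (Suc j) x = sin_convolution a j x"
  by (auto simp: sin_convolution_def Suc_diff_le intro!: sum.cong)

lemma has_real_derivative_power_over_fact:
  "((\<lambda>x. x ^ Suc n / fact (Suc n)) has_real_derivative x ^ n / fact n) (at x within S)"
  by (rule DERIV_cong[OF DERIV_cdivide[OF DERIV_pow]]) (simp add: divide_simps)

lemma has_real_derivative_sin_convolution [derivative_intros]:
  "(sin_convolution a j has_real_derivative cos_convolution a j x) (at x within S)"
  unfolding sin_convolution_def[abs_def] cos_convolution_def Suc_eq_plus1[symmetric]
  by (intro DERIV_sum DERIV_cmult has_real_derivative_power_over_fact)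

lemma has_real_derivative_cos_convolution [derivative_intros]:
  "(cos_convolution a j has_real_derivative - sin_convolution (case_nat 0 a) j x) (at x within S)"
proof (cases j)
  case 0
  then show ?thesis
    by (simp add: cos_convolution_def[abs_def] sin_convolution_def)
next
  case (Suc j')
  have "((\<lambda>x. a (Suc j') + (\<Sum>i\<le>j'. a (j' - i) * ((-1) ^ Suc i * (x ^ Suc (2 * i + 1) / fact (Suc (2 * i + 1))))))
      has_real_derivative 0 + (\<Sum>i\<le>j'. a (j' - i) * ((-1) ^ Suc i * (x ^ (2 * i + 1) / fact (2 * i + 1)))))
      (at x within S)"
    by (intro DERIV_add DERIV_const DERIV_sum DERIV_cmult has_real_derivative_power_over_fact)
  then show ?thesis
    unfolding Suc sin_convolution_shift
    by (simp add: cos_convolution_def[abs_def] sin_convolution_def sum.atMost_Suc_shift flip: sum_negf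
        del: sum.atMost_Suc fact_Suc)
qed

definition abs_sin_cos_limit :: "nat \<Rightarrow> real \<Rightarrow> real" where
  "abs_sin_cos_limit j x = cos_convolution abs_sin_moment j x
     + sin_convolution (case_nat 0 (\<lambda>n. pi / 2 * 4 ^ n)) j x - pi / 4 * 4 ^ j * sin (x / 2)"

definition abs_sin_sin_limit :: "nat \<Rightarrow> real \<Rightarrow> real" where
  "abs_sin_sin_limit j x = sin_convolution abs_sin_moment j x
     - cos_convolution (\<lambda>n. pi / 2 * 4 ^ n) j x + pi / 2 * 4 ^ j * cos (x / 2)"

lemma has_real_derivative_abs_sin_sin_limit:
  "(abs_sin_sin_limit j has_real_derivative abs_sin_cos_limit j x) (at x within S)"
  unfolding abs_sin_sin_limit_def[abs_def] abs_sin_cos_limit_def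
  by (rule derivative_eq_intros refl | simp)+

lemma has_real_derivative_abs_sin_cos_limit:
  "(abs_sin_cos_limit (Suc j) has_real_derivative - abs_sin_sin_limit j x) (at x within S)"
  unfolding abs_sin_sin_limit_def abs_sin_cos_limit_def[abs_def] sin_convolution_shift
  by (rule derivative_eq_intros refl | simp add: sin_convolution_shift)+

lemma abs_sin_sin_limit_sums_if_cos:
  assumes cos: "\<And>x. x \<in> {0..2 * pi} \<Longrightarrow>
      (\<lambda>k. abs_sin_weight (2 * j) k * cos (real (Suc k) * x)) sums abs_sin_cos_limit j x"
    and x: "x \<in> {0..2 * pi}"
  shows "(\<lambda>k. abs_sin_weight (2 * j + 1) k * sin (real (Suc k) * x)) sums abs_sin_sin_limit j x"
proof (rule sums_antiderivative[OF _ _ _ sums_summable[OF abs_sin_coeff_sums]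
      cos has_real_derivative_abs_sin_sin_limit _ _ x])
  show "((\<lambda>x. abs_sin_weight (2 * j + 1) k * sin (real (Suc k) * x)) has_real_derivative
      abs_sin_weight (2 * j) k * cos (real (Suc k) * x)) (at x within {0..2 * pi})" for k x
    unfolding abs_sin_weight_def by (rule derivative_eq_intros refl | simp)+
  show "norm (abs_sin_weight (2 * j) k * cos (real (Suc k) * x)) \<le> abs_sin_coeff (Suc k)" for k x
    unfolding real_norm_def by (rule abs_sin_weight_mult_le) simp
  show "(\<lambda>k. abs_sin_weight (2 * j + 1) k * sin (real (Suc k) * 0)) sums abs_sin_sin_limit j 0"
    by (simp add: abs_sin_sin_limit_def)
qed auto

lemma abs_sin_cos_limit_sums:
  assumes "x \<in> {0..2 * pi}"
  shows "(\<lambda>k. abs_sin_weight (2 * j) k * cos (real (Suc k) * x)) sums abs_sin_cos_limit j x"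
  using assms
proof (induction j arbitrary: x)
  case 0
  then have "sin (x / 2) \<ge> 0"
    by (intro sin_ge_zero) auto
  moreover have "2 * real (Suc k) * (x / 2) = real (Suc k) * x" for k
    by simp
  ultimately show ?case
    using abs_sin_cos_sums[of "x / 2"]
    by (simp only:)
      (simp add: abs_sin_weight_def abs_sin_cos_limit_def cos_convolution_def sin_convolution_def abs_sin_moment_0)
next
  case (Suc j)
  show ?case
  proof (rule sums_antiderivative[OF _ _ _ sums_summable[OF abs_sin_coeff_sums]
        sums_minus[OF abs_sin_sin_limit_sums_if_cos] has_real_derivative_abs_sin_cos_limit _ _ Suc.prems])
    show "((\<lambda>x. abs_sin_weight (2 * Suc j) k * cos (real (Suc k) * x)) has_real_derivative
        - (abs_sin_weight (2 * j + 1) k * sin (real (Suc k) * x))) (at x within {0..2 * pi})" for k x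
      unfolding abs_sin_weight_def by (rule derivative_eq_intros refl | simp)+
    show "norm (- (abs_sin_weight (2 * j + 1) k * sin (real (Suc k) * x))) \<le> abs_sin_coeff (Suc k)" for k x
      unfolding real_norm_def abs_minus by (rule abs_sin_weight_mult_le) simp
    show "(\<lambda>k. abs_sin_weight (2 * Suc j) k * cos (real (Suc k) * 0)) sums abs_sin_cos_limit (Suc j) 0"
      using abs_sin_moment_sums[of "Suc j"] by (simp add: abs_sin_cos_limit_def)
  qed (use Suc.IH in auto)
qed

lemma abs_sin_moment_recurrence:
  "(\<Sum>i\<le>j. abs_sin_moment (j - i) * ((-1) ^ i * (pi ^ (2 * i) / fact (2 * i + 1))))
     = (\<Sum>i\<le>j. 4 ^ (j - i) / 2 * ((-1) ^ i * (pi ^ (2 * i) / fact (2 * i))))"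
proof -
  have "(\<lambda>k. abs_sin_weight (2 * j + 1) k * sin (real (Suc k) * pi)) sums abs_sin_sin_limit j pi"
    by (intro abs_sin_sin_limit_sums_if_cos abs_sin_cos_limit_sums) auto
  then have "(\<lambda>k. 0) sums abs_sin_sin_limit j pi"
    by (simp only: sin_npi mult_zero_right)
  then have "sin_convolution abs_sin_moment j pi = cos_convolution (\<lambda>n. pi / 2 * 4 ^ n) j pi"
    using sums_unique2[OF sums_zero] by (fastforce simp: abs_sin_sin_limit_def)
  moreover have "sin_convolution abs_sin_moment j pi
      = pi * (\<Sum>i\<le>j. abs_sin_moment (j - i) * ((-1) ^ i * (pi ^ (2 * i) / fact (2 * i + 1))))"
    by (simp add: sin_convolution_def sum_distrib_left mult_ac)
  moreover have "cos_convolution (\<lambda>n. pi / 2 * 4 ^ n) j pi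
      = pi * (\<Sum>i\<le>j. 4 ^ (j - i) / 2 * ((-1) ^ i * (pi ^ (2 * i) / fact (2 * i))))"
    by (simp add: cos_convolution_def sum_distrib_left mult_ac)
  ultimately show ?thesis
    by simp
qed

lemma abs_sin_moment_eqs:
  "abs_sin_moment 1 = 2 - pi^2 / 6"
  "abs_sin_moment 2 = 8 - 2 * pi^2 / 3 - pi^4 / 90"
  "abs_sin_moment 3 = 32 - 8 * pi^2 / 3 - 2 * pi^4 / 45 - pi^6 / 945"
  "abs_sin_moment 4 = 128 - 32 * pi^2 / 3 - 8 * pi^4 / 45 - 4 * pi^6 / 945 - pi^8 / 9450"
  "abs_sin_moment 5 = 512 - 128 * pi^2 / 3 - 32 * pi^4 / 45 - 16 * pi^6 / 945 - 2 * pi^8 / 4725 - pi^10 / 93555"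
proof -
  note recurrence_simps = abs_sin_moment_0 atMost_nat_numeral fact_numeral field_simps power_numeral_reduce
  show moment_1: "abs_sin_moment 1 = 2 - pi^2 / 6"
    using abs_sin_moment_recurrence[of 1] by (simp add: recurrence_simps)
  show moment_2: "abs_sin_moment 2 = 8 - 2 * pi^2 / 3 - pi^4 / 90"
    using abs_sin_moment_recurrence[of 2] by (simp add: moment_1[simplified] recurrence_simps)
  show moment_3: "abs_sin_moment 3 = 32 - 8 * pi^2 / 3 - 2 * pi^4 / 45 - pi^6 / 945"
    using abs_sin_moment_recurrence[of 3] by (simp add: moment_1[simplified] moment_2 recurrence_simps)
  show moment_4: "abs_sin_moment 4 = 128 - 32 * pi^2 / 3 - 8 * pi^4 / 45 - 4 * pi^6 / 945 - pi^8 / 9450"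
    using abs_sin_moment_recurrence[of 4] by (simp add: moment_1[simplified] moment_2 moment_3 recurrence_simps)
  show "abs_sin_moment 5 = 512 - 128 * pi^2 / 3 - 32 * pi^4 / 45 - 16 * pi^6 / 945 - 2 * pi^8 / 4725 - pi^10 / 93555"
    using abs_sin_moment_recurrence[of 5] by (simp add: moment_1[simplified] moment_2 moment_3 moment_4 recurrence_simps)
qed

subsection \<open>Sums of reciprocals of odd numbers\<close>

definition odd_harm :: "nat \<Rightarrow> real" where
  "odd_harm m = (\<Sum>j<m. 1 / (2 * real j + 1))"

lemma odd_harm_eq_harm: "odd_harm m = harm (2 * m) - harm m / 2"
proof (induction m)
  case (Suc m)
  have "harm (2 * Suc m) = harm (2 * m) + 1 / (2 * real m + 1) + 1 / (real (Suc m) * 2)"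
    by (simp add: harm_Suc inverse_eq_divide add_ac)
  moreover have "harm (Suc m) / 2 = harm m / 2 + 1 / (real (Suc m) * 2)"
    by (simp add: harm_Suc inverse_eq_divide add_divide_distrib)
  moreover have "odd_harm (Suc m) = odd_harm m + 1 / (2 * real m + 1)"
    by (simp add: odd_harm_def)
  ultimately show ?case
    using Suc by linarith
qed (simp add: odd_harm_def harm_def)

lemma odd_harm_minus_ln_tendsto:
  "(\<lambda>m. odd_harm m - ln (real m) / 2) \<longlonglongrightarrow> (euler_mascheroni + 2 * ln 2) / 2"
proof -
  have "(\<lambda>m. harm (2 * m) - ln (real (2 * m))) \<longlonglongrightarrow> (euler_mascheroni :: real)"
    using filterlim_compose[OF euler_mascheroni_LIMSEQ filterlim_subseq[of "\<lambda>m. 2 * m"]]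
    by (simp add: strict_mono_def)
  then have "(\<lambda>m. (harm (2 * m) - ln (real (2 * m))) - (harm m - ln (real m)) / 2 + ln 2)
     \<longlonglongrightarrow> euler_mascheroni - euler_mascheroni / 2 + (ln 2 :: real)"
    by (intro tendsto_intros euler_mascheroni_LIMSEQ) auto
  also have "euler_mascheroni - euler_mascheroni / 2 + ln 2 = (euler_mascheroni + 2 * ln 2) / (2 :: real)"
    by (simp add: field_simps)
  finally show ?thesis
  proof (rule Lim_transform_eventually)
    show "\<forall>\<^sub>F m in sequentially. (harm (2 * m) - ln (real (2 * m))) - (harm m - ln (real m)) / 2 + ln 2
       = odd_harm m - ln (real m) / 2"
      using eventually_gt_at_top[of 0]
      by eventually_elim (simp add: odd_harm_eq_harm ln_mult field_simps)
  qed
qed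

text \<open>The entry at \<open>j > 0\<close> is \<open>B (1/2 - 4^(-j)) / (2 j)\<close> with the Bernoulli number \<open>B\<close> of index
  \<open>2 j\<close>; the entry at \<open>0\<close> is a placeholder.\<close>

definition odd_harm_coeff :: "nat \<Rightarrow> real" where
  "odd_harm_coeff j = [0, 1/48, -7/1920, 31/16128, -127/61440, 511/135168] ! j"

definition odd_harm_tail :: "real \<Rightarrow> real" where
  "odd_harm_tail u = (\<Sum>j = 1..5. odd_harm_coeff j * u ^ (2 * j))"

lemma odd_harm_tail_eq:
  "odd_harm_tail u = 1/48 * u^2 - 7/1920 * u^4 + 31/16128 * u^6 - 127/61440 * u^8 + 511/135168 * u^10"
  by (simp add: odd_harm_tail_def odd_harm_coeff_def numeral_eq_Suc)

definition odd_harm_remainder :: "nat \<Rightarrow> real" where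
  "odd_harm_remainder m = odd_harm m - ln (real m) / 2 - (euler_mascheroni + 2 * ln 2) / 2 - odd_harm_tail (1 / real m)"

lemma odd_harm_remainder_tendsto_0: "odd_harm_remainder \<longlonglongrightarrow> 0"
proof -
  have "(\<lambda>m::nat. odd_harm_tail (1 / real m)) \<longlonglongrightarrow> 0"
    unfolding odd_harm_tail_eq by real_asymp
  from tendsto_diff[OF LIM_zero[OF odd_harm_minus_ln_tendsto] this] show ?thesis
    by (simp add: odd_harm_remainder_def[abs_def])
qed

definition odd_harm_increment :: "real \<Rightarrow> real" where
  "odd_harm_increment h = h - (ln (1 + h) - ln (1 - h)) / 2
     - odd_harm_tail (2 * (h / (1 + h))) + odd_harm_tail (2 * (h / (1 - h)))"

text \<open>Since \<open>m + 1 = (1 + h) / (2 h)\<close> and \<open>m = (1 - h) / (2 h)\<close> for \<open>h = 1 / (2 m + 1)\<close>, the increment is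
  an odd function of \<open>h\<close>.\<close>

lemma odd_harm_remainder_increment:
  assumes "m > 0"
  shows "odd_harm_remainder (Suc m) - odd_harm_remainder m = odd_harm_increment (1 / (2 * real m + 1))"
proof -
  define h where "h = 1 / (2 * real m + 1)"
  have "h > 0" and one_plus: "1 + h = 2 * h * real (Suc m)" and one_minus: "1 - h = 2 * h * real m"
    by (simp_all add: h_def field_simps)
  then have "ln (1 + h) - ln (1 - h) = ln (real (Suc m)) - ln (real m)"
    using assms by (simp add: ln_mult)
  moreover have "2 * (h / (1 + h)) = 1 / real (Suc m)" "2 * (h / (1 - h)) = 1 / real m"
    unfolding one_plus one_minus using \<open>h > 0\<close> by (simp_all del: of_nat_Suc)
  moreover have "odd_harm (Suc m) = odd_harm m + h"
    by (simp add: odd_harm_def h_def)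
  ultimately show ?thesis
    unfolding odd_harm_remainder_def odd_harm_increment_def h_def[symmetric]
    by (simp only: diff_divide_distrib)
qed

lemma odd_harm_increment_bigo: "odd_harm_increment \<in> O[at_right 0](\<lambda>h. h ^ 13)"
  unfolding odd_harm_increment_def odd_harm_tail_eq by real_asymp

lemma odd_harm_remainder_bigo: "odd_harm_remainder \<in> O(\<lambda>m. 1 / real m ^ 12)"
proof (rule bigo_of_increments[OF odd_harm_remainder_tendsto_0])
  have "filterlim (\<lambda>m. 1 / (2 * real m + 1)) (at_right 0) sequentially"
    by real_asymp
  from landau_o.big.compose[OF odd_harm_increment_bigo this]
  have "(\<lambda>m. odd_harm_remainder (Suc m) - odd_harm_remainder m) \<in> O(\<lambda>m. (1 / (2 * real m + 1)) ^ 13)"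
    by (rule landau_o.big.in_cong[THEN iffD1, rotated])
      (use eventually_gt_at_top[of 0] in eventually_elim, simp add: odd_harm_remainder_increment)
  also have "(\<lambda>m. (1 / (2 * real m + 1)) ^ 13) \<in> O(\<lambda>m. 1 / real (Suc m) ^ 12 - 1 / real m ^ 12)"
    by real_asymp
  finally show "(\<lambda>m. odd_harm_remainder (Suc m) - odd_harm_remainder m)
      \<in> O(\<lambda>m. 1 / real (Suc m) ^ 12 - 1 / real m ^ 12)" .
  show "(\<lambda>m. 1 / real m ^ 12) \<longlonglongrightarrow> 0"
    "\<forall>\<^sub>F m in sequentially. 1 / real (Suc m) ^ 12 \<le> 1 / real m ^ 12"
    by real_asymp+
qed

subsection \<open>Szego's formula\<close>

lemma sin_times_sum_sin_odd:
  fixes y :: real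
  shows "sin y * (\<Sum>j<m. sin ((2 * real j + 1) * y)) = (sin (real m * y))\<^sup>2"
proof -
  have "sin y * sin ((2 * real j + 1) * y) = (sin (real (Suc j) * y))\<^sup>2 - (sin (real j * y))\<^sup>2" for j
  proof -
    have "sin (a - b) * sin (a + b) = (sin a)\<^sup>2 - (sin b)\<^sup>2" for a b :: real
      unfolding sin_add sin_diff
      using sin_cos_squared_add[of a] sin_cos_squared_add[of b] by algebra
    from this[of "real (Suc j) * y" "real j * y"] show ?thesis
      by (simp add: algebra_simps)
  qed
  then show ?thesis
    by (simp only: sum_distrib_left sum_lessThan_telescope[of "\<lambda>j. (sin (real j * y))\<^sup>2"]) simp
qed

lemma sin_times_sum_cos:
  fixes y :: real
  shows "sin y * (\<Sum>j<n. cos ((real n - 1 - 2 * real j) * y)) = sin (real n * y)"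
proof -
  have "sin y * cos ((real n - 1 - 2 * real j) * y)
      = (sin ((real n - 2 * real j) * y) - sin ((real n - 2 * real (Suc j)) * y)) / 2" for j
  proof -
    have "sin y * cos a = (sin (a + y) - sin (a - y)) / 2" for a
      by (simp add: sin_add sin_diff)
    from this[of "(real n - 1 - 2 * real j) * y"] show ?thesis
      by (simp add: algebra_simps)
  qed
  then show ?thesis
    by (simp only: sum_distrib_left sum_divide_distrib[symmetric]
        sum_lessThan_telescope'[of "\<lambda>j. sin ((real n - 2 * real j) * y)"]) simp
qed

lemma has_integral_sin_odd_half:
  "((\<lambda>t. sin ((2 * real j + 1) * (t / 2))) has_integral 2 / (2 * real j + 1)) {0..pi}"
proof -
  define F where "F t = - 2 * cos ((2 * real j + 1) * (t / 2)) / (2 * real j + 1)" for t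
  have "((\<lambda>t. sin ((2 * real j + 1) * (t / 2))) has_integral F pi - F 0) {0..pi}"
  proof (rule fundamental_theorem_of_calculus)
    show "(F has_vector_derivative sin ((2 * real j + 1) * (t / 2))) (at t within {0..pi})" for t
      unfolding F_def has_real_derivative_iff_has_vector_derivative[symmetric]
      by (rule derivative_eq_intros refl | simp add: add_nonneg_pos)+
  qed simp
  moreover have "F pi = 0"
  proof -
    have "(2 * real j + 1) * (pi / 2) = real j * pi + pi / 2"
      by (simp add: field_simps)
    then have "cos ((2 * real j + 1) * (pi / 2)) = 0"
      by (simp only: cos_add) simp
    then show ?thesis
      by (simp only: F_def)
  qed
  ultimately show ?thesis
    by (simp add: F_def)
qed

lemma has_integral_reflect_even:
  fixes f :: "real \<Rightarrow> real"
  assumes f: "(f has_integral i) {0..a}" and "0 \<le> a" and even: "\<And>x. f (- x) = f x"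
  shows "(f has_integral 2 * i) {-a..a}"
proof -
  have "(f has_integral i) {-a..0}"
    using has_integral_reflect_real[of f i a 0] f by (simp add: even)
  from has_integral_combine[OF _ _ this f] \<open>0 \<le> a\<close> show ?thesis
    by simp
qed

lemma has_integral_sin_square_over_sin:
  "((\<lambda>t. (sin (real m * (t / 2)))\<^sup>2 / \<bar>sin (t / 2)\<bar>) has_integral 4 * odd_harm m) {-pi..pi}"
proof -
  have "((\<lambda>t. \<Sum>j<m. sin ((2 * real j + 1) * (t / 2))) has_integral (\<Sum>j<m. 2 / (2 * real j + 1))) {0..pi}"
    by (intro has_integral_sum has_integral_sin_odd_half) auto
  also have "(\<Sum>j<m. 2 / (2 * real j + 1)) = 2 * odd_harm m"
    by (simp add: odd_harm_def sum_distrib_left)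
  finally have "((\<lambda>t. (sin (real m * (t / 2)))\<^sup>2 / \<bar>sin (t / 2)\<bar>) has_integral 2 * odd_harm m) {0..pi}"
  proof (rule has_integral_spike_finite[of "{0}", rotated 2])
    fix t assume "t \<in> {0..pi} - {0}"
    then have "sin (t / 2) > 0"
      by (intro sin_gt_zero) auto
    then show "(sin (real m * (t / 2)))\<^sup>2 / \<bar>sin (t / 2)\<bar> = (\<Sum>j<m. sin ((2 * real j + 1) * (t / 2)))"
      using sin_times_sum_sin_odd[of "t / 2" m] by (simp add: field_simps)
  qed simp
  from has_integral_reflect_even[OF this] show ?thesis
    by simp
qed

lemma integrable_lebesgue_kernel:
  "(\<lambda>t. \<bar>sin (real n * (t / 2)) / sin (t / 2)\<bar>) integrable_on {-pi..pi}"
proof (rule integrable_spike_finite[of "{0}"])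
  show "(\<lambda>t. \<bar>\<Sum>j<n. cos ((real n - 1 - 2 * real j) * (t / 2))\<bar>) integrable_on {-pi..pi}"
    by (intro integrable_continuous_interval continuous_intros) auto
  show "\<bar>sin (real n * (t / 2)) / sin (t / 2)\<bar> = \<bar>\<Sum>j<n. cos ((real n - 1 - 2 * real j) * (t / 2))\<bar>"
    if t: "t \<in> {-pi..pi} - {0}" for t
  proof -
    have "- pi < t / 2" "t / 2 < pi"
      using t pi_gt_zero by (simp_all only: Diff_iff atLeastAtMost_iff) linarith+
    then have "sin (t / 2) \<noteq> 0"
      using sin_eq_0_pi[of "t / 2"] t by auto
    then show ?thesis
      unfolding sin_times_sum_cos[symmetric] by simp
  qed
qed simp

lemma lebesgue_const_sums:
  "(\<lambda>k. abs_sin_coeff (Suc k) * odd_harm (Suc k * Suc n)) sums (pi\<^sup>2 / 16 * lebesgue_const (real n / 2))"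
proof -
  define f where
    "f k t = abs_sin_coeff (Suc k) * ((sin (real (Suc k * Suc n) * (t / 2)))\<^sup>2 / \<bar>sin (t / 2)\<bar>)" for k t
  define g where "g t = pi / 8 * \<bar>sin (real (Suc n) * (t / 2)) / sin (t / 2)\<bar>" for t
  have f_nonneg: "f k t \<ge> 0" for k t
    using abs_sin_coeff_pos[of "Suc k"] by (simp add: f_def)
  have f_sums: "(\<lambda>k. f k t) sums g t" for t
    using sums_divide[OF abs_sin_sin_square_sums[of "real (Suc n) * (t / 2)"], of "\<bar>sin (t / 2)\<bar>"]
    unfolding f_def g_def of_nat_mult by (simp add: abs_divide mult.assoc del: of_nat_Suc)
  have f_integral: "((\<lambda>t. \<Sum>k<K. f k t) has_integral
      (\<Sum>k<K. abs_sin_coeff (Suc k) * (4 * odd_harm (Suc k * Suc n)))) {-pi..pi}" for K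
    unfolding f_def by (intro has_integral_sum has_integral_mult_right has_integral_sin_square_over_sin) auto
  have "(\<lambda>K. integral {-pi..pi} (\<lambda>t. \<Sum>k<K. f k t)) \<longlonglongrightarrow> integral {-pi..pi} g"
  proof (rule dominated_convergence(2))
    show "(\<lambda>t. \<Sum>k<K. f k t) integrable_on {-pi..pi}" for K
      using f_integral by blast
    show "g integrable_on {-pi..pi}"
      unfolding g_def by (intro integrable_on_mult_right integrable_lebesgue_kernel)
    show "(\<lambda>K. \<Sum>k<K. f k t) \<longlonglongrightarrow> g t" for t
      using f_sums unfolding sums_def .
    show "norm (\<Sum>k<K. f k t) \<le> g t" for K t
      using sum_le_suminf[OF sums_summable[OF f_sums], of "{..<K}" t] f_nonneg
      by (simp add: sums_unique[OF f_sums] sum_nonneg)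
  qed
  moreover have "integral {-pi..pi} g = pi / 8 * (2 * pi * lebesgue_const (real n / 2))"
    unfolding g_def integral_mult_right lebesgue_const_half by (simp add: add.commute)
  ultimately have "(\<lambda>k. abs_sin_coeff (Suc k) * (4 * odd_harm (Suc k * Suc n))) sums
      (pi / 8 * (2 * pi * lebesgue_const (real n / 2)))"
    by (simp add: sums_def integral_unique[OF f_integral])
  from sums_divide[OF this, of 4] show ?thesis
    by (simp add: power2_eq_square mult.assoc)
qed

subsection \<open>Asymptotic expansion of the Lebesgue constants\<close>

definition lebesgue_coeff :: "nat \<Rightarrow> real" where
  "lebesgue_coeff j = 16 / pi\<^sup>2 * (odd_harm_coeff j * abs_sin_moment j)"

definition lebesgue_tail :: "real \<Rightarrow> real" where
  "lebesgue_tail y = (\<Sum>j = 1..5. lebesgue_coeff j / y ^ j)"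

lemma odd_harm_tail_sums:
  "(\<lambda>k. abs_sin_coeff (Suc k) * odd_harm_tail (1 / real (Suc k * N)))
     sums (pi\<^sup>2 / 16 * lebesgue_tail (real N ^ 2))"
proof -
  have "(\<lambda>k. \<Sum>j = 1..5. odd_harm_coeff j / real N ^ (2 * j) * abs_sin_weight (2 * j) k)
      sums (\<Sum>j = 1..5. odd_harm_coeff j / real N ^ (2 * j) * abs_sin_moment j)"
    by (intro sums_sum sums_mult abs_sin_moment_sums)
  moreover have "(\<Sum>j = 1..5. odd_harm_coeff j / real N ^ (2 * j) * abs_sin_weight (2 * j) k)
      = abs_sin_coeff (Suc k) * odd_harm_tail (1 / real (Suc k * N))" for k
    unfolding odd_harm_tail_def abs_sin_weight_def of_nat_mult
    by (simp add: sum_distrib_left power_divide power_mult_distrib mult_ac del: of_nat_Suc)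
  moreover have "(\<Sum>j = 1..5. odd_harm_coeff j / real N ^ (2 * j) * abs_sin_moment j)
      = pi\<^sup>2 / 16 * lebesgue_tail (real N ^ 2)"
    by (simp add: lebesgue_tail_def lebesgue_coeff_def sum_distrib_left power_mult)
  ultimately show ?thesis
    by (simp only:)
qed

lemma abs_sin_coeff_ln_summable: "summable (\<lambda>k. abs_sin_coeff (Suc k) * ln (real (Suc k)))"
proof (rule summable_comparison_test_bigo)
  show "summable (\<lambda>k. norm (1 / real k powr (3/2)))"
    using summable_real_powr_iff[of "-3/2"] by (simp add: powr_minus_divide)
  show "(\<lambda>k. abs_sin_coeff (Suc k) * ln (real (Suc k))) \<in> O(\<lambda>k. 1 / real k powr (3/2))"
    unfolding abs_sin_coeff_def by real_asymp
qed

lemma odd_harm_remainder_sums: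
  "(\<lambda>k. abs_sin_coeff (Suc k) * odd_harm_remainder (Suc k * Suc n)) sums
     (pi\<^sup>2 / 16 * (lebesgue_const (real n / 2) - MC\<^sub>0 n - lebesgue_tail (real (Suc n) ^ 2)))"
proof -
  let ?c = "\<lambda>k. abs_sin_coeff (Suc k)"
  define S where "S = (\<Sum>k. ?c k * ln (real (Suc k)))"
  define N where "N = Suc n"
  define \<kappa> :: real where "\<kappa> = (euler_mascheroni + 2 * ln 2) / 2"
  have "(\<lambda>k. ?c k * odd_harm (Suc k * N) - ?c k * ln (real (Suc k)) / 2 - ?c k * (ln (real N) / 2 + \<kappa>)
        - ?c k * odd_harm_tail (1 / real (Suc k * N))) sums
      (pi\<^sup>2 / 16 * lebesgue_const (real n / 2) - S / 2 - 1 / 2 * (ln (real N) / 2 + \<kappa>)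
        - pi\<^sup>2 / 16 * lebesgue_tail (real N ^ 2))"
    unfolding N_def S_def
    by (intro sums_diff sums_divide sums_mult2 lebesgue_const_sums odd_harm_tail_sums abs_sin_coeff_sums
        summable_sums abs_sin_coeff_ln_summable)
  moreover have "?c k * odd_harm (Suc k * N) - ?c k * ln (real (Suc k)) / 2 - ?c k * (ln (real N) / 2 + \<kappa>)
        - ?c k * odd_harm_tail (1 / real (Suc k * N)) = ?c k * odd_harm_remainder (Suc k * N)" for k
  proof -
    have "ln (real (Suc k * N)) = ln (real (Suc k)) + ln (real N)"
      unfolding of_nat_mult by (simp add: N_def ln_mult del: of_nat_Suc)
    then show ?thesis
      unfolding odd_harm_remainder_def \<kappa>_def[symmetric]
      by (simp add: algebra_simps add_divide_distrib del: of_nat_Suc of_nat_mult)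
  qed
  moreover have "pi\<^sup>2 / 16 * MC\<^sub>0 n = S / 2 + 1 / 2 * (ln (real N) / 2 + \<kappa>)"
    by (simp add: MC\<^sub>0_def c\<^sub>1_def S_def abs_sin_coeff_def \<kappa>_def N_def field_simps)
  ultimately show ?thesis
    by (simp only: N_def right_diff_distrib diff_diff_eq[symmetric])
qed

theorem lebesgue_const_expansion:
  "(\<lambda>n. lebesgue_const (real n / 2) - MC\<^sub>0 n - lebesgue_tail (real (Suc n) ^ 2)) \<in> O(\<lambda>n. 1 / real (Suc n) ^ 12)"
proof -
  have "(\<lambda>n. pi\<^sup>2 / 16 * (lebesgue_const (real n / 2) - MC\<^sub>0 n - lebesgue_tail (real (Suc n) ^ 2)))
      \<in> O(\<lambda>n. 1 / real (Suc n) ^ 12)"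
    using odd_harm_remainder_bigo sums_summable[OF abs_sin_coeff_sums] less_imp_le[OF abs_sin_coeff_pos]
      odd_harm_remainder_sums
    by (rule bigo_sum_dilations) simp
  then show ?thesis
    by simp
qed

subsection \<open>Matching with the continued fractions\<close>

lemma pi_square_bounds: "9.8696 \<le> pi\<^sup>2" "pi\<^sup>2 \<le> 9.8697"
proof -
  have "(3.141592653588 :: real)\<^sup>2 \<le> pi\<^sup>2" "pi\<^sup>2 \<le> (3.1415926535899 :: real)\<^sup>2"
    using pi_approx by (auto intro!: power_mono)
  then show "9.8696 \<le> pi\<^sup>2" "pi\<^sup>2 \<le> 9.8697"
    by (simp_all add: power2_eq_square)
qed

text \<open>Up to sign and scaling, this is the numerator of \<open>\<rho>\<^sub>2\<close> and \<open>C\<^sub>1\<close>, and a factor of the denominators of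
  \<open>\<sigma>\<^sub>2\<close> and \<open>C\<^sub>2\<close>.\<close>

definition \<Delta> :: real where
  "\<Delta> = 7515244800 - 1252540800 * pi^2 + 46937520 * pi^4 + 65640 * pi^6 + 23797 * pi^8"

lemma \<Delta>_pos: "\<Delta> > 0"
proof -
  have "(9.8696::real) ^ i \<le> (pi\<^sup>2) ^ i" for i
    using pi_square_bounds by (intro power_mono) auto
  from this[of 2] this[of 3] this[of 4] pi_square_bounds show ?thesis
    unfolding \<Delta>_def by (simp add: power_divide flip: power_mult)
qed

lemma lebesgue_coeff_eqs:
  "lebesgue_coeff 1 = 16 / pi\<^sup>2 * (1/48 * (2 - pi^2 / 6))"
  "lebesgue_coeff 2 = 16 / pi\<^sup>2 * (-7/1920 * (8 - 2 * pi^2 / 3 - pi^4 / 90))"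
  "lebesgue_coeff 3 = 16 / pi\<^sup>2 * (31/16128 * (32 - 8 * pi^2 / 3 - 2 * pi^4 / 45 - pi^6 / 945))"
  "lebesgue_coeff 4 = 16 / pi\<^sup>2 * (-127/61440 * (128 - 32 * pi^2 / 3 - 8 * pi^4 / 45 - 4 * pi^6 / 945 - pi^8 / 9450))"
  "lebesgue_coeff 5 = 16 / pi\<^sup>2 * (511/135168 *
     (512 - 128 * pi^2 / 3 - 32 * pi^4 / 45 - 16 * pi^6 / 945 - 2 * pi^8 / 4725 - pi^10 / 93555))"
  unfolding lebesgue_coeff_def abs_sin_moment_eqs by (simp_all add: odd_harm_coeff_def)

lemma C\<^sub>1_eq: "C\<^sub>1 = - \<Delta> / (952560000 * pi\<^sup>2 * (pi\<^sup>2 - 12))"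
  by (simp add: C\<^sub>1_def \<Delta>_def)

lemma \<rho>\<^sub>2_eq: "\<rho>\<^sub>2 = - (\<Delta> / (52920000 * (pi\<^sup>2 - 12)\<^sup>2))"
  by (simp add: \<rho>\<^sub>2_def \<Delta>_def)

definition \<sigma>\<^sub>2_numerator :: real where
  "\<sigma>\<^sub>2_numerator = 7 * (-36262162944000 + 9065540736000 * pi^2 - 720128102400 * pi^4
              + 16206350400 * pi^6 + 117169920 * pi^8 + 288540 * pi^10 + 230953 * pi^12)"

lemma \<sigma>\<^sub>2_eq: "\<sigma>\<^sub>2 = \<sigma>\<^sub>2_numerator / (600 * ((pi\<^sup>2 - 12) * \<Delta>))"
proof -
  have "-90182937600 + 22545734400 * pi^2 - 1815791040 * pi^4
              + 46149840 * pi^6 - 219924 * pi^8 + 23797 * pi^10 = (pi\<^sup>2 - 12) * \<Delta>"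
    unfolding \<Delta>_def by algebra
  then show ?thesis
    by (simp only: \<sigma>\<^sub>2_def \<sigma>\<^sub>2_numerator_def)
qed

lemma pade_relations:
  "lebesgue_coeff 1 = \<rho>\<^sub>1"
  "lebesgue_coeff 2 + \<sigma>\<^sub>1 * \<rho>\<^sub>1 = 0"
  "lebesgue_coeff 3 + \<sigma>\<^sub>1 * lebesgue_coeff 2 = C\<^sub>1"
  "C\<^sub>1 + \<rho>\<^sub>2 * \<rho>\<^sub>1 = 0"
  "lebesgue_coeff 4 + \<sigma>\<^sub>1 * lebesgue_coeff 3 + \<rho>\<^sub>2 * lebesgue_coeff 2 + \<sigma>\<^sub>2 * C\<^sub>1 = 0"
  "lebesgue_coeff 5 + \<sigma>\<^sub>1 * lebesgue_coeff 4 + \<rho>\<^sub>2 * lebesgue_coeff 3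
     + \<sigma>\<^sub>2 * (lebesgue_coeff 4 + \<sigma>\<^sub>1 * lebesgue_coeff 3) = C\<^sub>2"
proof -
  have [simp]: "pi\<^sup>2 \<noteq> 12" "\<Delta> \<noteq> 0"
    using pi_square_bounds \<Delta>_pos by auto
  show "lebesgue_coeff 1 = \<rho>\<^sub>1"
    unfolding lebesgue_coeff_eqs \<rho>\<^sub>1_def by (simp add: divide_simps)
  show "lebesgue_coeff 2 + \<sigma>\<^sub>1 * \<rho>\<^sub>1 = 0"
    unfolding lebesgue_coeff_eqs \<rho>\<^sub>1_def \<sigma>\<^sub>1_def by (simp add: divide_simps) algebra
  show "lebesgue_coeff 3 + \<sigma>\<^sub>1 * lebesgue_coeff 2 = C\<^sub>1"
    unfolding lebesgue_coeff_eqs \<sigma>\<^sub>1_def C\<^sub>1_def by (simp add: divide_simps) algebra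
  show "C\<^sub>1 + \<rho>\<^sub>2 * \<rho>\<^sub>1 = 0"
    unfolding C\<^sub>1_eq \<rho>\<^sub>2_eq \<rho>\<^sub>1_def by (simp add: divide_simps) algebra
  have "\<sigma>\<^sub>2 * C\<^sub>1 = - \<sigma>\<^sub>2_numerator / (571536000000 * pi\<^sup>2 * (pi\<^sup>2 - 12)\<^sup>2)"
    unfolding \<sigma>\<^sub>2_eq C\<^sub>1_eq by (simp add: divide_simps) algebra
  then show "lebesgue_coeff 4 + \<sigma>\<^sub>1 * lebesgue_coeff 3 + \<rho>\<^sub>2 * lebesgue_coeff 2 + \<sigma>\<^sub>2 * C\<^sub>1 = 0"
    unfolding lebesgue_coeff_eqs \<sigma>\<^sub>1_def \<rho>\<^sub>2_def \<sigma>\<^sub>2_numerator_def by (simp add: divide_simps) algebra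
  show "lebesgue_coeff 5 + \<sigma>\<^sub>1 * lebesgue_coeff 4 + \<rho>\<^sub>2 * lebesgue_coeff 3
     + \<sigma>\<^sub>2 * (lebesgue_coeff 4 + \<sigma>\<^sub>1 * lebesgue_coeff 3) = C\<^sub>2"
    unfolding lebesgue_coeff_eqs \<sigma>\<^sub>1_def \<rho>\<^sub>2_eq \<sigma>\<^sub>2_eq C\<^sub>2_def N\<^sub>2_def \<Delta>_def[symmetric]
    by (simp add: divide_simps) (unfold \<Delta>_def \<sigma>\<^sub>2_numerator_def, algebra)
qed

lemma inverse_powers_mult_quadratic:
  fixes y :: "'a :: field"
  assumes "y \<noteq> 0"
  shows "(a1 / y + a2 / y^2 + a3 / y^3 + a4 / y^4 + a5 / y^5) * (y^2 + s * y + q)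
    = a1 * y + (a2 + s * a1) + (a3 + s * a2 + q * a1) / y + (a4 + s * a3 + q * a2) / y^2
      + (a5 + s * a4 + q * a3) / y^3 + (s * a5 + q * a4) / y^4 + q * a5 / y^5"
  using assms by (simp add: field_simps power_numeral_reduce)

lemma pade_bigo:
  fixes a1 a2 a3 a4 a5 s q :: real
  assumes "(\<lambda>y. (a3 + s * a2 + q * a1) / y + (a4 + s * a3 + q * a2) / y^2 + (a5 + s * a4 + q * a3) / y^3
        + (s * a5 + q * a4) / y^4 + q * a5 / y^5) \<in> O[at_top](\<lambda>y. 1 / y^m)" (is "?residual \<in> _")
  shows "(\<lambda>y. a1 / y + a2 / y^2 + a3 / y^3 + a4 / y^4 + a5 / y^5 - (a1 * y + (a2 + s * a1)) / (y^2 + s * y + q))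
     \<in> O[at_top](\<lambda>y. 1 / y^(m + 2))" (is "?f \<in> _")
proof -
  let ?D = "\<lambda>y. y^2 + s * y + q"
  have "\<forall>\<^sub>F y in at_top. ?D y > 0"
    by real_asymp
  then have "\<forall>\<^sub>F y in at_top. ?residual y = ?f y * ?D y"
    using eventually_gt_at_top[of 0]
  proof eventually_elim
    case (elim y)
    then have "(a1 * y + (a2 + s * a1)) / ?D y * ?D y = a1 * y + (a2 + s * a1)"
      by simp
    then show ?case
      using elim inverse_powers_mult_quadratic[of y a1 a2 a3 a4 a5 s q] by (simp only: left_diff_distrib)
  qed
  with assms have "(\<lambda>y. ?f y * ?D y) \<in> O[at_top](\<lambda>y. 1 / y^m)"
    by (simp only: landau_o.big.in_cong)
  then have "?f \<in> O[at_top](\<lambda>y. 1 / y^m * (1 / y^2))"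
    by (rule bigo_of_bigo_mult) real_asymp+
  then show ?thesis
    unfolding power_add by simp
qed

lemma lebesgue_tail_eq:
  "lebesgue_tail y = lebesgue_coeff 1 / y + lebesgue_coeff 2 / y^2 + lebesgue_coeff 3 / y^3
     + lebesgue_coeff 4 / y^4 + lebesgue_coeff 5 / y^5"
  by (simp add: lebesgue_tail_def numeral_eq_Suc)

lemma lebesgue_tail_MC\<^sub>1_bigo:
  "(\<lambda>y. lebesgue_tail y - C\<^sub>1 / y^3 - \<rho>\<^sub>1 / (y + \<sigma>\<^sub>1)) \<in> O[at_top](\<lambda>y. 1 / y^4)"
proof -
  let ?a = lebesgue_coeff
  \<comment> \<open>The fraction is extended by \<open>y\<close>, so that the quadratic denominator has constant coefficient \<open>0\<close>.\<close>
  have relations: "?a 2 + \<sigma>\<^sub>1 * ?a 1 = 0" "(?a 3 - C\<^sub>1) + \<sigma>\<^sub>1 * ?a 2 + 0 * ?a 1 = 0"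
    using pade_relations(1-3) by simp_all
  have "(\<lambda>y. c / y^2 + d / y^3 + e / y^4) \<in> O[at_top](\<lambda>y. 1 / y^2)" for c d e :: real
    by (intro sum_in_bigo) real_asymp+
  then have "(\<lambda>y. ?a 1 / y + ?a 2 / y^2 + (?a 3 - C\<^sub>1) / y^3 + ?a 4 / y^4 + ?a 5 / y^5
      - (?a 1 * y + (?a 2 + \<sigma>\<^sub>1 * ?a 1)) / (y^2 + \<sigma>\<^sub>1 * y + 0)) \<in> O[at_top](\<lambda>y. 1 / y^(2 + 2))"
    by (intro pade_bigo) (simp only: relations, simp)
  moreover have "\<forall>\<^sub>F y in at_top. ?a 1 / y + ?a 2 / y^2 + (?a 3 - C\<^sub>1) / y^3 + ?a 4 / y^4 + ?a 5 / y^5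
      - (?a 1 * y + (?a 2 + \<sigma>\<^sub>1 * ?a 1)) / (y^2 + \<sigma>\<^sub>1 * y + 0) = lebesgue_tail y - C\<^sub>1 / y^3 - \<rho>\<^sub>1 / (y + \<sigma>\<^sub>1)"
    using eventually_gt_at_top[of 0]
  proof eventually_elim
    case (elim y)
    have denominator: "y^2 + \<sigma>\<^sub>1 * y + 0 = (y + \<sigma>\<^sub>1) * y"
      by (simp add: power2_eq_square distrib_right)
    show ?case
      unfolding relations(1) denominator unfolding lebesgue_tail_eq pade_relations(1)
      using elim by (simp add: diff_divide_distrib)
  qed
  ultimately show ?thesis
    by (simp only: landau_o.big.in_cong) simp
qed

lemma lebesgue_tail_MC\<^sub>2_bigo:
  "(\<lambda>y. lebesgue_tail y - C\<^sub>2 / y^5 - \<rho>\<^sub>1 / (y + \<sigma>\<^sub>1 + \<rho>\<^sub>2 / (y + \<sigma>\<^sub>2))) \<in> O[at_top](\<lambda>y. 1 / y^6)"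
proof -
  let ?a = lebesgue_coeff and ?s = "\<sigma>\<^sub>1 + \<sigma>\<^sub>2" and ?q = "\<sigma>\<^sub>1 * \<sigma>\<^sub>2 + \<rho>\<^sub>2"
  have numerator: "?a 2 + ?s * ?a 1 = \<rho>\<^sub>1 * \<sigma>\<^sub>2"
    using pade_relations(2) unfolding pade_relations(1) by algebra
  have relations: "?a 3 + ?s * ?a 2 + ?q * ?a 1 = 0" "?a 4 + ?s * ?a 3 + ?q * ?a 2 = 0"
    "(?a 5 - C\<^sub>2) + ?s * ?a 4 + ?q * ?a 3 = 0"
  proof -
    show "?a 3 + ?s * ?a 2 + ?q * ?a 1 = 0"
      using pade_relations(2-4) unfolding pade_relations(1) by algebra
    show "?a 4 + ?s * ?a 3 + ?q * ?a 2 = 0"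
      using pade_relations(5) unfolding pade_relations(3)[symmetric] by (simp add: algebra_simps)
    show "(?a 5 - C\<^sub>2) + ?s * ?a 4 + ?q * ?a 3 = 0"
      using pade_relations(6) by (simp add: algebra_simps)
  qed
  have "(\<lambda>y. c / y^4 + d / y^5) \<in> O[at_top](\<lambda>y. 1 / y^4)" for c d :: real
    by (intro sum_in_bigo) real_asymp+
  then have "(\<lambda>y. ?a 1 / y + ?a 2 / y^2 + ?a 3 / y^3 + ?a 4 / y^4 + (?a 5 - C\<^sub>2) / y^5
      - (?a 1 * y + (?a 2 + ?s * ?a 1)) / (y^2 + ?s * y + ?q)) \<in> O[at_top](\<lambda>y. 1 / y^(4 + 2))"
    by (intro pade_bigo) (simp only: relations, simp)
  moreover have "\<forall>\<^sub>F y in at_top. ?a 1 / y + ?a 2 / y^2 + ?a 3 / y^3 + ?a 4 / y^4 + (?a 5 - C\<^sub>2) / y^5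
      - (?a 1 * y + (?a 2 + ?s * ?a 1)) / (y^2 + ?s * y + ?q)
      = lebesgue_tail y - C\<^sub>2 / y^5 - \<rho>\<^sub>1 / (y + \<sigma>\<^sub>1 + \<rho>\<^sub>2 / (y + \<sigma>\<^sub>2))"
    using eventually_gt_at_top[of "- \<sigma>\<^sub>2"]
  proof eventually_elim
    case (elim y)
    then have denominator: "y + \<sigma>\<^sub>1 + \<rho>\<^sub>2 / (y + \<sigma>\<^sub>2) = (y^2 + ?s * y + ?q) / (y + \<sigma>\<^sub>2)"
      by (simp add: field_simps power2_eq_square)
    show ?case
      unfolding numerator denominator unfolding lebesgue_tail_eq pade_relations(1)
      by (simp add: diff_divide_distrib distrib_left)
  qed
  ultimately show ?thesis
    by (simp only: landau_o.big.in_cong) simp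
qed

lemma MC_error_bigo:
  assumes "k \<in> {1, 2}"
  shows "(\<lambda>n. MC_error k n - MC_limit k / real (Suc n) ^ (4 * k + 2)) \<in> O(\<lambda>n. 1 / real (Suc n) ^ (4 * k + 2 + 2))"
proof -
  have squares: "filterlim (\<lambda>n. real (Suc n) ^ 2) at_top sequentially"
    by real_asymp
  let ?r = "\<lambda>n. lebesgue_const (real n / 2) - MC\<^sub>0 n - lebesgue_tail (real (Suc n) ^ 2)"
  from assms consider (one) "k = 1" | (two) "k = 2"
    by auto
  then show ?thesis
  proof cases
    case one
    have remainder: "?r \<in> O(\<lambda>n. 1 / real (Suc n) ^ 8)"
      by (rule landau_o.big_trans[OF lebesgue_const_expansion]) real_asymp
    have "(\<lambda>n. lebesgue_tail (real (Suc n) ^ 2) - C\<^sub>1 / real (Suc n) ^ 6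
        - \<rho>\<^sub>1 / (real (Suc n) ^ 2 + \<sigma>\<^sub>1)) \<in> O(\<lambda>n. 1 / real (Suc n) ^ 8)"
      using landau_o.big.compose[OF lebesgue_tail_MC\<^sub>1_bigo squares] by (simp flip: power_mult)
    from sum_in_bigo(1)[OF remainder this] show ?thesis
      by (simp add: one MC_error_def MC_limit_def MC_def MC\<^sub>1_def algebra_simps)
  next
    case two
    have "(\<lambda>n. lebesgue_tail (real (Suc n) ^ 2) - C\<^sub>2 / real (Suc n) ^ 10
        - \<rho>\<^sub>1 / (real (Suc n) ^ 2 + \<sigma>\<^sub>1 + \<rho>\<^sub>2 / (real (Suc n) ^ 2 + \<sigma>\<^sub>2))) \<in> O(\<lambda>n. 1 / real (Suc n) ^ 12)"
      using landau_o.big.compose[OF lebesgue_tail_MC\<^sub>2_bigo squares] by (simp flip: power_mult)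
    from sum_in_bigo(1)[OF lebesgue_const_expansion this] show ?thesis
      by (simp add: two MC_error_def MC_limit_def MC_def MC\<^sub>2_def Let_def algebra_simps)
  qed
qed

theorem theorem3:
  fixes k :: nat
  assumes "k \<in> {1, 2}"
  shows "(\<lambda>n. real n ^ (4 * k + 3) * (MC_error k n - MC_error k (n + 1)))
           \<longlonglongrightarrow> (4 * real k + 2) * MC_limit k
       \<and> (\<lambda>n. real n ^ (4 * k + 2) * MC_error k n) \<longlonglongrightarrow> MC_limit k"
proof -
  have "4 * k + 2 + 1 = 4 * k + 3" "real (4 * k + 2) = 4 * real k + 2"
    by simp_all
  with inverse_power_expansion_limits[OF MC_error_bigo[OF assms]] show ?thesis
    by metis
qed

end
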